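(* Let $\mathbf{k}$ be a field of characteristic not equal to $2$, let $(A,\cdot)$ be a $\mathbf{k}$-algebra and let $(R,\circ,\ell,r)$ be an $A$-bimodule $\mathbf{k}$-algebra. Let $\delta_+,\delta_-:R\to A$ be two linear maps, let $\lambda,\kappa,\mu\in\mathbf{k}$, and put $\alpha=(\delta_++\delta_-)/2$, $\beta=(\delta_+-\delta_-)/2$. (i) Suppose that $\beta$ is a balanced linear map of mass $(\kappa,\mu)$ and that $$\alpha(u)\cdot\alpha(v)-\alpha\big(\ell(\alpha(u))v+u\,r(\alpha(v))+\lambda\,u\circ v\big)=\kappa\,\beta(u)\cdot\beta(v)+\mu\,\beta(u\circ v)\qquad\text{for all }u,v\in R.$$ Then the product $u\ast_\alpha v:=\ell(\alpha(u))v+u\,r(\alpha(v))+\lambda\,u\circ v$ on $R$ is associative. (ii) Fix a sign $\pm$ (all signs $\pm$, $\mp$ below being read correspondingly). Suppose that $\beta$ is a balanced $A$-bimodule homomorphism of mass $(-1,\pm\lambda)$. Define $u\circ_\pm v:=\lambda\,u\circ v\mp 2\,\ell(\beta(u))v$ for $u,v\in R$. Then $\circ_\pm$ is associative, $(R,\circ_\pm,\ell,r)$ is an $A$-bimodule $\mathbf{k}$-algebra, and $\alpha$ is an extended $\mathcal{O}$-operator of weight $\lambda$ with modification $\beta$ of mass $(\kappa,\mu)=(-1,\pm\lambda)$ if and only if $\delta_\pm$ is an $\mathcal{O}$-operator of weight $1$ associated to $(R,\circ_\pm,\ell,r)$, that is, $$\delta_\pm(u)\cdot\delta_\pm(v)=\delta_\pm\big(\ell(\delta_\pm(u))v+u\,r(\delta_\pm(v))+u\circ_\pm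 v\big)\qquad\text{for all }u,v\in R.$$
   Context: A $\mathbf{k}$-algebra is an associative, not necessarily unital, algebra over $\mathbf{k}$. An $A$-bimodule $(V,\ell,r)$ is a vector space $V$ with linear maps $\ell,r:A\to\mathrm{End}_{\mathbf{k}}(V)$ (with $\ell(x)$ written on the left and $r(x)$ on the right) such that $\ell(x\cdot y)v=\ell(x)(\ell(y)v)$, $v\,r(x\cdot y)=(v\,r(x))r(y)$, $(\ell(x)v)r(y)=\ell(x)(v\,r(y))$. An $A$-bimodule $\mathbf{k}$-algebra $(R,\circ,\ell,r)$ is a $\mathbf{k}$-algebra $(R,\circ)$ with an $A$-bimodule structure $(R,\ell,r)$ such that for all $x\in A$, $v,w\in R$: $\ell(x)(v\circ w)=(\ell(x)v)\circ w$, $(v\circ w)r(x)=v\circ(w\,r(x))$, $(v\,r(x))\circ w=v\circ(\ell(x)w)$. A linear map $\beta:R\to A$ is balanced of mass $(\kappa,\mu)$ if $\kappa\,\ell(\beta(u))v=\kappa\,u\,r(\beta(v))$ and $\mu\,\ell(\beta(u\circ v))w=\mu\,u\,r(\beta(v\circ w))$ for all $u,v,w\in R$. It is a balanced $A$-bimodule homomorphism of mass $(\kappa,\mu)$ if in addition $\beta(\ell(x)u)=x\cdot\beta(u)$ and $\beta(u\,r(x))=\beta(u)\cdot x$ for all $x\in A$, $u\in R$. For a balanced $A$-bimodule homomorphism $\beta:R\to A$ of mass $(\kappa,\mu)$, a linear map $\alpha:R\to A$ is an extended $\mathcal{O}$-operator of weight $\lambda$ with modification $\beta$ of mass $(\kappa,\mu)$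 if $\alpha(u)\cdot\alpha(v)-\alpha(\ell(\alpha(u))v+u\,r(\alpha(v))+\lambda\,u\circ v)=\kappa\,\beta(u)\cdot\beta(v)+\mu\,\beta(u\circ v)$ for all $u,v\in R$. An $\mathcal{O}$-operator of weight $\lambda$ associated to $(R,\circ,\ell,r)$ is a linear map $\alpha:R\to A$ with $\alpha(u)\cdot\alpha(v)=\alpha(\ell(\alpha(u))v)+\alpha(u\,r(\alpha(v)))+\lambda\,\alpha(u\circ v)$ for all $u,v\in R$. *)

theory Defs
  imports Complex_Main
begin

text \<open>
  Products are explicit parameters rather than type class operations, because the same vector
  space carries several products. No unit is required.
\<close>

locale k_algebra = vector_space scale
  for scale :: "'k::field \<Rightarrow> 'a::ab_group_add \<Rightarrow> 'a" +
  fixes mult :: "'a \<Rightarrow> 'a \<Rightarrow> 'a"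
  assumes mult_linear_right: "Vector_Spaces.linear scale scale (\<lambda>y. mult x y)"
    and mult_linear_left: "Vector_Spaces.linear scale scale (\<lambda>x. mult x y)"
    and mult_assoc: "mult (mult x y) z = mult x (mult y z)"

text \<open>
  The element written $v\,r(x)$ in the literature is \<open>r x v\<close> here. Linearity of
  $\ell, r : A \to \mathrm{End}(V)$ is split into linearity of each \<open>l x\<close>, \<open>r x\<close> and linearity
  in \<open>x\<close> at each fixed vector.
\<close>

locale bimodule = A: k_algebra sA mult + V: vector_space sV
  for sA :: "'k::field \<Rightarrow> 'a::ab_group_add \<Rightarrow> 'a"
    and mult :: "'a \<Rightarrow> 'a \<Rightarrow> 'a"
    and sV :: "'k \<Rightarrow> 'v::ab_group_add \<Rightarrow> 'v" +
  fixes l r :: "'a \<Rightarrow> 'v \<Rightarrow> 'v"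
  assumes l_endo: "Vector_Spaces.linear sV sV (l x)"
    and r_endo: "Vector_Spaces.linear sV sV (r x)"
    and l_linear: "Vector_Spaces.linear sA sV (\<lambda>x. l x v)"
    and r_linear: "Vector_Spaces.linear sA sV (\<lambda>x. r x v)"
    and l_mult: "l (mult x y) v = l x (l y v)"
    and r_mult: "r (mult x y) v = r y (r x v)"
    and l_r_commute: "r y (l x v) = l x (r y v)"

locale bimodule_algebra =
  bimodule sA mult sR l r + R: k_algebra sR circ
  for sA :: "'k::field \<Rightarrow> 'a::ab_group_add \<Rightarrow> 'a"
    and mult :: "'a \<Rightarrow> 'a \<Rightarrow> 'a"
    and sR :: "'k \<Rightarrow> 'r::ab_group_add \<Rightarrow> 'r"
    and circ :: "'r \<Rightarrow> 'r \<Rightarrow> 'r"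
    and l r :: "'a \<Rightarrow> 'r \<Rightarrow> 'r" +
  assumes l_circ: "l x (circ v w) = circ (l x v) w"
    and r_circ: "r x (circ v w) = circ v (r x w)"
    and circ_r_l: "circ (r x v) w = circ v (l x w)"

definition balanced ::
  "('k::field \<Rightarrow> 'a::ab_group_add \<Rightarrow> 'a) \<Rightarrow> ('k \<Rightarrow> 'r::ab_group_add \<Rightarrow> 'r)
    \<Rightarrow> ('r \<Rightarrow> 'r \<Rightarrow> 'r) \<Rightarrow> ('a \<Rightarrow> 'r \<Rightarrow> 'r) \<Rightarrow> ('a \<Rightarrow> 'r \<Rightarrow> 'r)
    \<Rightarrow> 'k \<Rightarrow> 'k \<Rightarrow> ('r \<Rightarrow> 'a) \<Rightarrow> bool" where
  "balanced sA sR circ l r \<kappa> \<mu> \<beta> \<longleftrightarrow>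
     Vector_Spaces.linear sR sA \<beta> \<and>
     (\<forall>u v. sR \<kappa> (l (\<beta> u) v) = sR \<kappa> (r (\<beta> v) u)) \<and>
     (\<forall>u v w. sR \<mu> (l (\<beta> (circ u v)) w) = sR \<mu> (r (\<beta> (circ v w)) u))"

definition balanced_bimodule_hom ::
  "('k::field \<Rightarrow> 'a::ab_group_add \<Rightarrow> 'a) \<Rightarrow> ('a \<Rightarrow> 'a \<Rightarrow> 'a) \<Rightarrow> ('k \<Rightarrow> 'r::ab_group_add \<Rightarrow> 'r)
    \<Rightarrow> ('r \<Rightarrow> 'r \<Rightarrow> 'r) \<Rightarrow> ('a \<Rightarrow> 'r \<Rightarrow> 'r) \<Rightarrow> ('a \<Rightarrow> 'r \<Rightarrow> 'r)
    \<Rightarrow> 'k \<Rightarrow> 'k \<Rightarrow> ('r \<Rightarrow> 'a) \<Rightarrow> bool" where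
  "balanced_bimodule_hom sA mult sR circ l r \<kappa> \<mu> \<beta> \<longleftrightarrow>
     balanced sA sR circ l r \<kappa> \<mu> \<beta> \<and>
     (\<forall>x u. \<beta> (l x u) = mult x (\<beta> u)) \<and>
     (\<forall>x u. \<beta> (r x u) = mult (\<beta> u) x)"

definition star ::
  "('k \<Rightarrow> 'r::ab_group_add \<Rightarrow> 'r) \<Rightarrow> ('r \<Rightarrow> 'r \<Rightarrow> 'r) \<Rightarrow> ('a \<Rightarrow> 'r \<Rightarrow> 'r) \<Rightarrow> ('a \<Rightarrow> 'r \<Rightarrow> 'r)
    \<Rightarrow> 'k \<Rightarrow> ('r \<Rightarrow> 'a) \<Rightarrow> 'r \<Rightarrow> 'r \<Rightarrow> 'r" where
  "star sR circ l r lam \<alpha> u v = l (\<alpha> u) v + r (\<alpha> v) u + sR lam (circ u v)"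

definition extended_O_operator ::
  "('k::field \<Rightarrow> 'a::ab_group_add \<Rightarrow> 'a) \<Rightarrow> ('a \<Rightarrow> 'a \<Rightarrow> 'a) \<Rightarrow> ('k \<Rightarrow> 'r::ab_group_add \<Rightarrow> 'r)
    \<Rightarrow> ('r \<Rightarrow> 'r \<Rightarrow> 'r) \<Rightarrow> ('a \<Rightarrow> 'r \<Rightarrow> 'r) \<Rightarrow> ('a \<Rightarrow> 'r \<Rightarrow> 'r)
    \<Rightarrow> 'k \<Rightarrow> ('r \<Rightarrow> 'a) \<Rightarrow> 'k \<Rightarrow> 'k \<Rightarrow> ('r \<Rightarrow> 'a) \<Rightarrow> bool" where
  "extended_O_operator sA mult sR circ l r lam \<beta> \<kappa> \<mu> \<alpha> \<longleftrightarrow>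
     balanced_bimodule_hom sA mult sR circ l r \<kappa> \<mu> \<beta> \<and>
     Vector_Spaces.linear sR sA \<alpha> \<and>
     (\<forall>u v. mult (\<alpha> u) (\<alpha> v) - \<alpha> (l (\<alpha> u) v + r (\<alpha> v) u + sR lam (circ u v))
          = sA \<kappa> (mult (\<beta> u) (\<beta> v)) + sA \<mu> (\<beta> (circ u v)))"

definition O_operator ::
  "('k::field \<Rightarrow> 'a::ab_group_add \<Rightarrow> 'a) \<Rightarrow> ('a \<Rightarrow> 'a \<Rightarrow> 'a) \<Rightarrow> ('k \<Rightarrow> 'r::ab_group_add \<Rightarrow> 'r)
    \<Rightarrow> ('r \<Rightarrow> 'r \<Rightarrow> 'r) \<Rightarrow> ('a \<Rightarrow> 'r \<Rightarrow> 'r) \<Rightarrow> ('a \<Rightarrow> 'r \<Rightarrow> 'r)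
    \<Rightarrow> 'k \<Rightarrow> ('r \<Rightarrow> 'a) \<Rightarrow> bool" where
  "O_operator sA mult sR circ l r lam \<alpha> \<longleftrightarrow>
     Vector_Spaces.linear sR sA \<alpha> \<and>
     (\<forall>u v. mult (\<alpha> u) (\<alpha> v)
          = \<alpha> (l (\<alpha> u) v) + \<alpha> (r (\<alpha> v) u) + sA lam (\<alpha> (circ u v)))"

text \<open>
  The product $u \circ_\pm v = \lambda\, u \circ v \mp 2\,\ell(\beta(u))v$; the sign $\pm$ is the
  scalar \<open>\<epsilon> = \<plusminus>1\<close>.
\<close>

definition circ_sgn ::
  "('k::field \<Rightarrow> 'r::ab_group_add \<Rightarrow> 'r) \<Rightarrow> ('r \<Rightarrow> 'r \<Rightarrow> 'r) \<Rightarrow> ('a \<Rightarrow> 'r \<Rightarrow> 'r)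
    \<Rightarrow> 'k \<Rightarrow> ('r \<Rightarrow> 'a) \<Rightarrow> 'k \<Rightarrow> 'r \<Rightarrow> 'r \<Rightarrow> 'r" where
  "circ_sgn sR circ l lam \<beta> \<epsilon> u v = sR lam (circ u v) - sR (\<epsilon> * 2) (l (\<beta> u) v)"

end

theory Submission
  imports Defs
begin

text \<open>
  The defect of \<open>\<alpha>\<close> from being multiplicative for \<open>u *\<^sub>\<alpha> v\<close> enters the associator of
  \<open>*\<^sub>\<alpha>\<close> only through \<open>\<kappa> \<ell>(\<beta>(u)) \<ell>(\<beta>(v)) w\<close> and \<open>\<mu> \<ell>(\<beta>(u \<circ> v)) w\<close>, and balancedness moves
  both to the right-hand side. For part (ii) write \<open>\<delta> = \<alpha> + \<epsilon> \<beta>\<close> with \<open>\<epsilon>\<^sup>2 = 1\<close>. Since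
  \<open>\<ell>(\<beta>(u)) v = u r(\<beta>(v))\<close>, the term \<open>2 \<epsilon> \<ell>(\<beta>(u)) v\<close> produced by \<open>\<ell>(\<delta>(u)) v + u r(\<delta>(v))\<close>
  cancels against the one in \<open>u \<circ>\<^sub>\<plusminus> v\<close>, so that the argument of \<open>\<delta>\<close> is \<open>u *\<^sub>\<alpha> v\<close>, and
  expanding both sides turns one operator identity into the other.
\<close>

lemma linear_simps:
  assumes "Vector_Spaces.linear s t f"
  shows linear_add: "f (x + y) = f x + f y"
    and linear_diff: "f (x - y) = f x - f y"
    and linear_scale: "f (s c x) = t c (f x)"
  using assms module_hom.add[of s t f] module_hom.diff[of s t f] module_hom.scale[of s t f]
  by (simp_all add: Vector_Spaces.linear_def)

text \<open>Recovers \<open>\<delta>p\<close> and \<open>\<delta>m\<close> as sum and difference of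
  \<alpha> and \<beta>; this is where characteristic 2 must be excluded.\<close>

lemma (in vector_space) half_add_half_diff:
  assumes "(2::'a) \<noteq> 0"
  shows "scale (1 / 2) (x + y) + scale (1 / 2) (x - y) = x"
    and "scale (1 / 2) (x + y) - scale (1 / 2) (x - y) = y"
proof -
  have "scale (1 / 2) z + scale (1 / 2) z = z" for z
    using assms by (simp flip: scale_left_distrib)
  then show "scale (1 / 2) (x + y) + scale (1 / 2) (x - y) = x"
    and "scale (1 / 2) (x + y) - scale (1 / 2) (x - y) = y"
    by (simp_all add: scale_right_distrib scale_right_diff_distrib)
qed

lemma linear_scale_add_diff:
  assumes "Vector_Spaces.linear s t f" "Vector_Spaces.linear s t g"
  shows "Vector_Spaces.linear s t (\<lambda>x. t c (f x + g x))"
    and "Vector_Spaces.linear s t (\<lambda>x. t c (f x - g x))"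
proof -
  interpret vector_space_pair s t
    using assms(1) by (simp add: Vector_Spaces.linear_def vector_space_pair_def)
  show "Vector_Spaces.linear s t (\<lambda>x. t c (f x + g x))"
    and "Vector_Spaces.linear s t (\<lambda>x. t c (f x - g x))"
    using assms by (simp_all add: linear_compose_scale_right linear_compose_add linear_compose_sub)
qed

lemma two_neq_zero_if_CHAR_neq_two:
  assumes "CHAR('k::field) \<noteq> 2"
  shows "(2::'k) \<noteq> 0"
proof
  assume "(2::'k) = 0"
  then have "CHAR('k) dvd 2"
    using of_nat_eq_0_iff_char_dvd[where 'a = 'k, of 2] by simp
  then have "CHAR('k) \<le> 2" "CHAR('k) \<noteq> 0"
    by (auto intro!: Nat.gr0I dest: dvd_imp_le)
  with assms CHAR_not_1[where 'a = 'k] show False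
    by linarith
qed

context bimodule_algebra
begin

lemmas bilinear_simps =
  linear_simps[OF A.mult_linear_right] linear_simps[OF A.mult_linear_left]
  linear_simps[OF R.mult_linear_right] linear_simps[OF R.mult_linear_left]
  linear_simps[OF l_endo] linear_simps[OF r_endo]
  linear_simps[OF l_linear] linear_simps[OF r_linear]

lemmas scale_simps =
  A.scale_right_distrib A.scale_right_diff_distrib A.scale_left_distrib
  V.scale_right_distrib V.scale_right_diff_distrib V.scale_left_distrib

lemma semigroup_star:
  assumes bal: "balanced sA sR circ l r \<kappa> \<mu> \<beta>"
    and \<alpha>: "\<And>u v. mult (\<alpha> u) (\<alpha> v) - \<alpha> (l (\<alpha> u) v + r (\<alpha> v) u + sR lam (circ u v))
      = sA \<kappa> (mult (\<beta> u) (\<beta> v)) + sA \<mu> (\<beta> (circ u v))"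
  shows "semigroup (star sR circ l r lam \<alpha>)"
proof
  fix u v w
  let ?s = "star sR circ l r lam \<alpha>"
  \<comment> \<open>The hypothesis, solved for the value of \<alpha> at a product, eliminates
    \<alpha> from nested products.\<close>
  have \<alpha>_star: "\<alpha> (?s u v)
      = mult (\<alpha> u) (\<alpha> v) - sA \<kappa> (mult (\<beta> u) (\<beta> v)) - sA \<mu> (\<beta> (circ u v))" for u v
    using \<alpha>[of u v] by (simp add: star_def algebra_simps)
  have \<kappa>: "sR \<kappa> (l (\<beta> u) v) = sR \<kappa> (r (\<beta> v) u)" for u v
    using bal unfolding balanced_def by blast
  have \<mu>: "sR \<mu> (l (\<beta> (circ u v)) w) = sR \<mu> (r (\<beta> (circ v w)) u)"
    using bal unfolding balanced_def by blast
  \<comment> \<open>A single factor \<kappa> serves two exchanges: balance at (v, w), commute the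
    left and right actions, then balance at (u, v).\<close>
  have "sR \<kappa> (l (\<beta> u) (l (\<beta> v) w)) = l (\<beta> u) (sR \<kappa> (r (\<beta> w) v))"
    by (simp add: bilinear_simps flip: \<kappa>)
  also have "\<dots> = r (\<beta> w) (sR \<kappa> (l (\<beta> u) v))"
    by (simp add: bilinear_simps l_r_commute)
  finally have \<kappa>2: "sR \<kappa> (l (\<beta> u) (l (\<beta> v) w)) = sR \<kappa> (r (\<beta> w) (r (\<beta> v) u))"
    by (simp add: \<kappa> bilinear_simps)
  have "?s (?s u v) w
      = l (mult (\<alpha> u) (\<alpha> v) - sA \<kappa> (mult (\<beta> u) (\<beta> v)) - sA \<mu> (\<beta> (circ u v))) w
        + r (\<alpha> w) (?s u v) + sR lam (circ (?s u v) w)"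
    \<comment> \<open>Only the outer product is unfolded: the inner one must stay folded for
      \<open>\<alpha>_star\<close> to apply.\<close>
    by (subst star_def) (simp only: \<alpha>_star)
  also have "\<dots> = l (\<alpha> u) (?s v w)
        + r (mult (\<alpha> v) (\<alpha> w) - sA \<kappa> (mult (\<beta> v) (\<beta> w)) - sA \<mu> (\<beta> (circ v w))) u
        + sR lam (circ u (?s v w))"
    by (simp add: star_def bilinear_simps scale_simps l_mult r_mult l_r_commute l_circ r_circ
        circ_r_l R.mult_assoc \<kappa>2 \<mu> algebra_simps)
  also have "\<dots> = ?s u (?s v w)"
    by (simp only: star_def[of _ _ _ _ _ _ _ "?s v w"] \<alpha>_star)
  finally show "?s (?s u v) w = ?s u (?s v w)" .
qed

text \<open>The product combines \<open>circ\<close> with p(u, v) = \<open>l (\<beta> u) v\<close>.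
  By bilinearity, associativity splits: \<open>circ\<close> and p are each associative, while
  \<open>l_circ\<close> and \<open>l\<beta>_circ\<close> match the two kinds of mixed terms.\<close>

lemma bimodule_algebra_circ_sgn:
  assumes hom: "balanced_bimodule_hom sA mult sR circ l r (- 1) \<mu> \<beta>"
  shows "bimodule_algebra sA mult sR (circ_sgn sR circ l lam \<beta> \<epsilon>) l r"
proof -
  \<comment> \<open>Scaling by \<open>- 1\<close> is injective, so mass -1 gives balancing without a
    scalar.\<close>
  have lin: "Vector_Spaces.linear sR sA \<beta>"
    and bal: "l (\<beta> u) v = r (\<beta> v) u"
    and \<beta>l: "\<beta> (l x u) = mult x (\<beta> u)"
    and \<beta>r: "\<beta> (r x u) = mult (\<beta> u) x" for u v x
    using hom by (auto simp: balanced_bimodule_hom_def balanced_def)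
  let ?c = "circ_sgn sR circ l lam \<beta> \<epsilon>"
  \<comment> \<open>Both sides equal \<open>r (\<beta> w) (circ u v)\<close>.\<close>
  have l\<beta>_circ: "l (\<beta> (circ u v)) w = circ u (l (\<beta> v) w)" for u v w
    by (metis bal r_circ)
  note simps = circ_sgn_def bilinear_simps linear_simps[OF lin] scale_simps \<beta>l \<beta>r l_mult
    R.mult_assoc l\<beta>_circ V.scale_left_commute
  show ?thesis
  proof (intro bimodule_algebra.intro bimodule_axioms k_algebra.intro k_algebra_axioms.intro
      bimodule_algebra_axioms.intro V.vector_space_axioms)
    fix x u v w
    show "Vector_Spaces.linear sR sR (?c u)"
      by unfold_locales (simp_all add: simps mult_ac)
    show "Vector_Spaces.linear sR sR (\<lambda>u. ?c u v)"
      by unfold_locales (simp_all add: simps mult_ac)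
    show "?c (?c u v) w = ?c u (?c v w)"
      by (simp add: simps l_circ mult_ac)
    show "l x (?c u v) = ?c (l x u) v"
      by (simp add: simps l_circ)
    show "r x (?c u v) = ?c u (r x v)"
      by (simp add: simps r_circ l_r_commute)
    show "?c (r x u) v = ?c u (l x v)"
      by (simp add: simps circ_r_l)
  qed
qed

lemma extended_O_operator_iff_O_operator:
  assumes hom: "balanced_bimodule_hom sA mult sR circ l r (- 1) (\<epsilon> * lam) \<beta>"
    and lin_\<alpha>: "Vector_Spaces.linear sR sA \<alpha>"
    and lin_\<delta>: "Vector_Spaces.linear sR sA \<delta>"
    and \<delta>: "\<And>u. \<delta> u = \<alpha> u + sA \<epsilon> (\<beta> u)"
    and \<epsilon>: "\<epsilon> * \<epsilon> = 1"
  shows "extended_O_operator sA mult sR circ l r lam \<beta> (- 1) (\<epsilon> * lam) \<alpha>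
    \<longleftrightarrow> O_operator sA mult sR (circ_sgn sR circ l lam \<beta> \<epsilon>) l r 1 \<delta>"
proof -
  have lin: "Vector_Spaces.linear sR sA \<beta>"
    and bal: "r (\<beta> v) u = l (\<beta> u) v"
    and \<beta>l: "\<beta> (l x u) = mult x (\<beta> u)"
    and \<beta>r: "\<beta> (r x u) = mult (\<beta> u) x" for u v x
    using hom by (auto simp: balanced_bimodule_hom_def balanced_def)
  let ?c = "circ_sgn sR circ l lam \<beta> \<epsilon>"
  let ?s = "star sR circ l r lam \<alpha>"
  have two: "sR (\<epsilon> * 2) x = sR \<epsilon> x + sR \<epsilon> x" for x
    by (simp only: mult_2_right V.scale_left_distrib)
  have arg: "l (\<delta> u) v + r (\<delta> v) u + ?c u v = ?s u v" for u v
    by (simp add: \<delta> circ_sgn_def star_def bilinear_simps bal two)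
  have \<beta>_star: "\<beta> (?s u v) = mult (\<alpha> u) (\<beta> v) + mult (\<beta> u) (\<alpha> v) + sA lam (\<beta> (circ u v))"
    for u v
    by (simp add: star_def linear_simps[OF lin] \<beta>l \<beta>r)
  \<comment> \<open>The mixed products of \<alpha> and \<beta> cancel against those in
    \<open>\<epsilon> \<beta>(?s u v)\<close>. What remains is the product of the \<beta> values
    with factor \<open>\<epsilon> * \<epsilon> = 1\<close>, and \<open>\<beta> (circ u v)\<close>
    with factor \<open>- \<epsilon> * lam\<close>; this explains the mass
    \<open>(- 1, \<epsilon> * lam)\<close>.\<close>
  have "mult (\<delta> u) (\<delta> v) - \<delta> (l (\<delta> u) v + r (\<delta> v) u + ?c u v)
      = (mult (\<alpha> u) (\<alpha> v) - \<alpha> (?s u v))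
        - (sA (- 1) (mult (\<beta> u) (\<beta> v)) + sA (\<epsilon> * lam) (\<beta> (circ u v)))" for u v
    unfolding arg
    by (simp add: \<delta> \<beta>_star bilinear_simps scale_simps \<epsilon> algebra_simps)
  then have "mult (\<delta> u) (\<delta> v) = \<delta> (l (\<delta> u) v + r (\<delta> v) u + ?c u v)
      \<longleftrightarrow> mult (\<alpha> u) (\<alpha> v) - \<alpha> (?s u v)
        = sA (- 1) (mult (\<beta> u) (\<beta> v)) + sA (\<epsilon> * lam) (\<beta> (circ u v))" for u v
    by (metis eq_iff_diff_eq_0)
  then show ?thesis
    using hom lin_\<alpha> lin_\<delta>
    by (simp add: extended_O_operator_def O_operator_def linear_simps[OF lin_\<delta>] star_def)
qed

end

theorem theorem2p14:
  fixes sA :: "'k::field \<Rightarrow> 'a::ab_group_add \<Rightarrow> 'a"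
    and mult :: "'a \<Rightarrow> 'a \<Rightarrow> 'a"
    and sR :: "'k \<Rightarrow> 'r::ab_group_add \<Rightarrow> 'r"
    and circ :: "'r \<Rightarrow> 'r \<Rightarrow> 'r"
    and l r :: "'a \<Rightarrow> 'r \<Rightarrow> 'r"
    and \<delta>p \<delta>m \<alpha> \<beta> :: "'r \<Rightarrow> 'a"
    and lam \<kappa> \<mu> :: 'k
  assumes "CHAR('k) \<noteq> 2"
    and "k_algebra sA mult"
    and "bimodule_algebra sA mult sR circ l r"
    and "Vector_Spaces.linear sR sA \<delta>p"
    and "Vector_Spaces.linear sR sA \<delta>m"
    and "\<alpha> = (\<lambda>u. sA (1 / 2) (\<delta>p u + \<delta>m u))"
    and "\<beta> = (\<lambda>u. sA (1 / 2) (\<delta>p u - \<delta>m u))"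
  shows
    "(balanced sA sR circ l r \<kappa> \<mu> \<beta> \<and>
      (\<forall>u v. mult (\<alpha> u) (\<alpha> v) - \<alpha> (l (\<alpha> u) v + r (\<alpha> v) u + sR lam (circ u v))
           = sA \<kappa> (mult (\<beta> u) (\<beta> v)) + sA \<mu> (\<beta> (circ u v)))
      \<longrightarrow> semigroup (star sR circ l r lam \<alpha>))
     \<and>
     (\<forall>(\<epsilon>, \<delta>) \<in> {(1, \<delta>p), (-1, \<delta>m)}.
       balanced_bimodule_hom sA mult sR circ l r (-1) (\<epsilon> * lam) \<beta> \<longrightarrow>
       (let circ' = circ_sgn sR circ l lam \<beta> \<epsilon> in
          semigroup circ' \<and>
          bimodule_algebra sA mult sR circ' l r \<and>
          (extended_O_operator sA mult sR circ l r lam \<beta> (-1) (\<epsilon> * lam) \<alpha>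
             \<longleftrightarrow> O_operator sA mult sR circ' l r 1 \<delta>) \<and>
          (O_operator sA mult sR circ' l r 1 \<delta>
             \<longleftrightarrow> (\<forall>u v. mult (\<delta> u) (\<delta> v) = \<delta> (l (\<delta> u) v + r (\<delta> v) u + circ' u v)))))"
proof -
  interpret bimodule_algebra sA mult sR circ l r by fact
  have lin_\<alpha>: "Vector_Spaces.linear sR sA \<alpha>"
    unfolding assms(6) using assms(4,5) by (rule linear_scale_add_diff)
  have two: "(2::'k) \<noteq> 0"
    using assms(1) by (rule two_neq_zero_if_CHAR_neq_two)
  have \<delta>: "\<delta>p u = \<alpha> u + sA 1 (\<beta> u)" "\<delta>m u = \<alpha> u + sA (- 1) (\<beta> u)" for u
    unfolding assms(6,7) by (simp_all add: A.half_add_half_diff[OF two])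
  \<comment> \<open>Stated for any \<epsilon> of square 1, so that both signs are instances.\<close>
  have part2: "let circ' = circ_sgn sR circ l lam \<beta> \<epsilon> in
          semigroup circ' \<and>
          bimodule_algebra sA mult sR circ' l r \<and>
          (extended_O_operator sA mult sR circ l r lam \<beta> (-1) (\<epsilon> * lam) \<alpha>
             \<longleftrightarrow> O_operator sA mult sR circ' l r 1 \<delta>) \<and>
          (O_operator sA mult sR circ' l r 1 \<delta>
             \<longleftrightarrow> (\<forall>u v. mult (\<delta> u) (\<delta> v) = \<delta> (l (\<delta> u) v + r (\<delta> v) u + circ' u v)))"
    if hom: "balanced_bimodule_hom sA mult sR circ l r (-1) (\<epsilon> * lam) \<beta>"
      and lin: "Vector_Spaces.linear sR sA \<delta>"
      and \<delta>: "\<And>u. \<delta> u = \<alpha> u + sA \<epsilon> (\<beta> u)" and \<epsilon>: "\<epsilon> * \<epsilon> = 1" for \<epsilon> \<delta>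
  proof -
    interpret C: bimodule_algebra sA mult sR "circ_sgn sR circ l lam \<beta> \<epsilon>" l r
      using hom by (rule bimodule_algebra_circ_sgn)
    have "semigroup (circ_sgn sR circ l lam \<beta> \<epsilon>)"
      by unfold_locales (rule C.R.mult_assoc)
    \<comment> \<open>Linearity of \<delta> merges the three summands of
      \<open>O_operator_def\<close>, at weight 1, into one value of \<delta>.\<close>
    with extended_O_operator_iff_O_operator[OF hom lin_\<alpha> lin \<delta> \<epsilon>] lin show ?thesis
      by (simp add: Let_def C.bimodule_algebra_axioms O_operator_def linear_simps[OF lin])
  qed
  show ?thesis
    using semigroup_star part2[of 1 \<delta>p] part2[of "- 1" \<delta>m] assms(4,5) \<delta> by auto
qed

end
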